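(* Let $m,n\ge 3$ be integers, and let $\{|0\rangle,\dots,|m-1\rangle\}$ and $\{|0\rangle,\dots,|n-1\rangle\}$ be the computational bases of $\mathbb{C}^m$ and $\mathbb{C}^n$. The nine Domino states (unnormalized) $$|0\rangle|0\pm 1\rangle,\quad |0\pm 1\rangle|2\rangle,\quad |2\rangle|1\pm 2\rangle,\quad |1\pm 2\rangle|0\rangle,\quad |1\rangle|1\rangle,$$ together with the states $|i\rangle|j\rangle$, $i=3,4,\dots,m-1$, $j=3,4,\dots,n-1$, form a LOCC indistinguishable complete orthogonal product basis in $\mathbb{C}^m\otimes\mathbb{C}^n$.
   Context: Notation: $|a\pm b\rangle=|a\rangle\pm|b\rangle$, and states are normalized when regarded as quantum states. Two parties, $A^{(1)}$ holding $\mathbb{C}^m$ and $A^{(2)}$ holding $\mathbb{C}^n$, share the system. A complete orthogonal product basis is an orthogonal basis of the whole space consisting of product vectors. A POVM is a finite family of positive semidefinite operators summing to the identity. An LOCC$_r$ POVM is a POVM generated by the following procedure after $r$ rounds: in each round the parties, in order, each perform once a local measurement on their own part, chosen depending on all previously published outcomes, and publish the outcome. An LOCC POVM is one generated by such a procedure with some finite number of rounds. A set $S$ of states (written as density operators) is LOCC distinguishable if there is an LOCC POVM $\{M_j\}$ such that for every $j$, $\mathrm{Tr}(M_j\rho)\neq 0$ for at most one $\rho\in S$; otherwise it is LOCC indistinguishable.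
   Formalization: The added states are taken to be all |i⟩|j⟩ with i ≥ 3 or j ≥ 3 (i < m, j < n); with both i ≥ 3 and j ≥ 3, as written, there are only 9+(m−3)(n−3) states, which is fewer than mn unless m = n = 3, so they would not form a complete basis. *)

theory Defs
  imports "Jordan_Normal_Form.Schur_Decomposition"
begin

section \<open>Product vectors and product operators\<close>

text \<open>The space \<open>\<complex>\<^sup>m \<otimes> \<complex>\<^sup>n\<close> is \<open>carrier_vec (m * n)\<close>: the
  computational basis vector with first label i and second label j has index \<open>i * n + j\<close>.\<close>

definition tensor_vec :: "complex vec \<Rightarrow> complex vec \<Rightarrow> complex vec"  (infixr \<open>\<otimes>\<^sub>v\<close> 70)
  where "u \<otimes>\<^sub>v v = vec (dim_vec u * dim_vec v)
    (\<lambda>i. u $ (i div dim_vec v) * v $ (i mod dim_vec v))"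

definition tensor_mat :: "complex mat \<Rightarrow> complex mat \<Rightarrow> complex mat"  (infixr \<open>\<otimes>\<^sub>m\<close> 70)
  where "A \<otimes>\<^sub>m B = mat (dim_row A * dim_row B) (dim_col A * dim_col B)
    (\<lambda>(i, j). A $$ (i div dim_row B, j div dim_col B) * B $$ (i mod dim_row B, j mod dim_col B))"

definition product_vector :: "nat \<Rightarrow> nat \<Rightarrow> complex vec \<Rightarrow> bool"
  where "product_vector m n w \<longleftrightarrow> (\<exists>u \<in> carrier_vec m. \<exists>v \<in> carrier_vec n. w = u \<otimes>\<^sub>v v)"

definition complete_orthogonal_product_basis :: "nat \<Rightarrow> nat \<Rightarrow> complex vec set \<Rightarrow> bool"
  where "complete_orthogonal_product_basis m n S \<longleftrightarrow>
    vectorspace.basis class_ring (module_vec TYPE(complex) (m * n)) S \<and>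
    (\<forall>u \<in> S. \<forall>v \<in> S. u \<noteq> v \<longrightarrow> u \<bullet>c v = 0) \<and>
    (\<forall>w \<in> S. product_vector m n w)"


section \<open>States and measurements\<close>

definition density :: "complex vec \<Rightarrow> complex mat"
  where "density v = mat (dim_vec v) (dim_vec v) (\<lambda>(i, j). v $ i * cnj (v $ j) / (v \<bullet>c v))"

definition mat_trace :: "complex mat \<Rightarrow> complex"
  where "mat_trace A = (\<Sum>i<dim_row A. A $$ (i, i))"

definition mat_sum :: "nat \<Rightarrow> complex mat list \<Rightarrow> complex mat"
  where "mat_sum d Ms = foldr (+) Ms (0\<^sub>m d d)"

text \<open>The order on \<open>complex\<close> is \<open>x \<le> y \<longleftrightarrow> Re x \<le> Re y \<and> Im x = Im y\<close>, so that the
  following condition includes that the quadratic form is real.\<close>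

definition psd :: "nat \<Rightarrow> complex mat \<Rightarrow> bool"
  where "psd d M \<longleftrightarrow> M \<in> carrier_mat d d \<and> (\<forall>v \<in> carrier_vec d. 0 \<le> (M *\<^sub>v v) \<bullet>c v)"

definition povm :: "nat \<Rightarrow> complex mat list \<Rightarrow> bool"
  where "povm d Ms \<longleftrightarrow> (\<forall>M \<in> set Ms. psd d M) \<and> mat_sum d Ms = 1\<^sub>m d"

text \<open>A local measurement on a d-dimensional system is given by its measurement operators, one for
  each outcome. They need not be square: an outcome may leave the party with a system of another
  dimension, so attaching an ancilla and discarding a subsystem are covered.\<close>

definition measurement :: "nat \<Rightarrow> complex mat list \<Rightarrow> bool"
  where "measurement d Ks \<longleftrightarrow>
    (\<forall>K \<in> set Ks. dim_col K = d) \<and> mat_sum d (map (\<lambda>K. mat_adjoint K * K) Ks) = 1\<^sub>m d"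


section \<open>LOCC\<close>

text \<open>A history lists, round by round, the pairs of published outcomes. In the round after history
  h, the first party measures with \<open>a h\<close>; when the outcome is k, the second party then measures
  with \<open>b h k\<close>. A branch \<open>(h, A, B)\<close> records the operators A and B that the two parties have
  applied to their original systems along h.\<close>

type_synonym history = "(nat \<times> nat) list"

primrec branches :: "nat \<Rightarrow> nat \<Rightarrow> (history \<Rightarrow> complex mat list) \<Rightarrow>
    (history \<Rightarrow> nat \<Rightarrow> complex mat list) \<Rightarrow> nat \<Rightarrow> (history \<times> complex mat \<times> complex mat) list"
  where
    "branches m n a b 0 = [([], 1\<^sub>m m, 1\<^sub>m n)]"
  | "branches m n a b (Suc r) =
      [(h @ [(k, l)], (a h ! k) * A, (b h k ! l) * B).
        (h, A, B) \<leftarrow> branches m n a b r, k \<leftarrow> [0..<length (a h)], l \<leftarrow> [0..<length (b h k)]]"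

definition protocol :: "nat \<Rightarrow> nat \<Rightarrow> nat \<Rightarrow> (history \<Rightarrow> complex mat list) \<Rightarrow>
    (history \<Rightarrow> nat \<Rightarrow> complex mat list) \<Rightarrow> bool"
  where "protocol m n r a b \<longleftrightarrow>
    (\<forall>s < r. \<forall>(h, A, B) \<in> set (branches m n a b s).
      measurement (dim_row A) (a h) \<and>
      (\<forall>k < length (a h). measurement (dim_row B) (b h k)))"

definition locc_r_povm :: "nat \<Rightarrow> nat \<Rightarrow> nat \<Rightarrow> complex mat list \<Rightarrow> bool"
  where "locc_r_povm m n r Ms \<longleftrightarrow>
    (\<exists>a b. protocol m n r a b \<and>
      Ms = map (\<lambda>(h, A, B). mat_adjoint (A \<otimes>\<^sub>m B) * (A \<otimes>\<^sub>m B)) (branches m n a b r))"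

definition locc_povm :: "nat \<Rightarrow> nat \<Rightarrow> complex mat list \<Rightarrow> bool"
  where "locc_povm m n Ms \<longleftrightarrow> (\<exists>r. locc_r_povm m n r Ms)"

lemma mat_adjoint_index [simp]:
  "dim_row (mat_adjoint A) = dim_col A" "dim_col (mat_adjoint A) = dim_row A"
  "i < dim_col A \<Longrightarrow> j < dim_row A \<Longrightarrow> mat_adjoint A $$ (i, j) = conjugate (A $$ (j, i))"
  by (auto simp: mat_adjoint_def mat_of_rows_def)

lemma tensor_mat_dim [simp]:
  "dim_row (A \<otimes>\<^sub>m B) = dim_row A * dim_row B" "dim_col (A \<otimes>\<^sub>m B) = dim_col A * dim_col B"
  by (auto simp: tensor_mat_def)

lemma gram_index:
  fixes A :: "complex mat"
  assumes "i < dim_col A" "j < dim_col A"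
  shows "(mat_adjoint A * A) $$ (i, j) = (\<Sum>k<dim_row A. cnj (A $$ (k, i)) * A $$ (k, j))"
  using assms by (auto simp: scalar_prod_def atLeast0LessThan intro!: sum.cong)

lemma sum_lessThan_mult:
  fixes f :: "nat \<Rightarrow> 'a :: comm_monoid_add"
  shows "(\<Sum>k<p * q. f k) = (\<Sum>x<p. \<Sum>y<q. f (x * q + y))"
proof (induction p)
  case (Suc p)
  have "(\<Sum>k<p * q + q. f k) = (\<Sum>k<p * q. f k) + (\<Sum>y<q. f (p * q + y))"
    using sum.atLeastLessThan_concat[of 0 "p * q" "p * q + q" f]
      sum.shift_bounds_nat_ivl[of f 0 "p * q" q] by (simp add: atLeast0LessThan add.commute)
  then show ?case using Suc by (simp add: add.commute)
qed simp

lemma gram_tensor_index: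
  assumes i: "i < dim_col A * dim_col B" and j: "j < dim_col A * dim_col B"
  defines "q \<equiv> dim_col B"
  shows "(mat_adjoint (A \<otimes>\<^sub>m B) * (A \<otimes>\<^sub>m B)) $$ (i, j) =
    (mat_adjoint A * A) $$ (i div q, j div q) * (mat_adjoint B * B) $$ (i mod q, j mod q)"
proof -
  have q: "0 < q" using i unfolding q_def by (cases "dim_col B") auto
  have "(mat_adjoint (A \<otimes>\<^sub>m B) * (A \<otimes>\<^sub>m B)) $$ (i, j) =
     (\<Sum>k<dim_row A * dim_row B. cnj ((A \<otimes>\<^sub>m B) $$ (k, i)) * (A \<otimes>\<^sub>m B) $$ (k, j))"
    by (subst gram_index) (use i j in auto)
  also have "\<dots> = (\<Sum>x<dim_row A. \<Sum>y<dim_row B.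
      (cnj (A $$ (x, i div q)) * A $$ (x, j div q)) * (cnj (B $$ (y, i mod q)) * B $$ (y, j mod q)))"
    unfolding sum_lessThan_mult
  proof (intro sum.cong refl, goal_cases)
    case (1 x y)
    have "x * dim_row B + y < (x + 1) * dim_row B" using 1 by simp
    also have "\<dots> \<le> dim_row A * dim_row B" using 1 by (intro mult_right_mono) auto
    finally have "x * dim_row B + y < dim_row A * dim_row B" .
    then show ?case using 1 i j by (simp add: tensor_mat_def q_def)
  qed
  also have "\<dots> = (mat_adjoint A * A) $$ (i div q, j div q) * (mat_adjoint B * B) $$ (i mod q, j mod q)"
    using i j q
    by (subst (1 2) gram_index) (auto simp: q_def sum_product less_mult_imp_div_less)
  finally show ?thesis .
qed

lemma mat_sum_dim:
  assumes "\<forall>M \<in> set Ms. M \<in> carrier_mat d d"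
  shows "mat_sum d Ms \<in> carrier_mat d d"
  using assms unfolding mat_sum_def by (induction Ms) auto

lemma mat_sum_index:
  assumes "\<forall>M \<in> set Ms. M \<in> carrier_mat d d" "i < d" "j < d"
  shows "mat_sum d Ms $$ (i, j) = (\<Sum>M\<leftarrow>Ms. M $$ (i, j))"
  using assms(1)
proof (induction Ms)
  case (Cons M Ms)
  then show ?case using mat_sum_dim[of Ms d] assms by (simp add: mat_sum_def)
qed (use assms in \<open>simp add: mat_sum_def\<close>)

lemma sum_list_sum_swap:
  "(\<Sum>x\<leftarrow>xs. \<Sum>y\<in>Y. f x y) = (\<Sum>y\<in>Y. \<Sum>x\<leftarrow>xs. f x y :: 'a :: comm_monoid_add)"
  by (induction xs) (auto simp: sum.distrib)

lemma measurement_gram: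
  assumes K: "measurement (dim_row A) Ks" and i: "i < dim_col A" and j: "j < dim_col A"
  shows "(\<Sum>K\<leftarrow>Ks. (mat_adjoint (K * A) * (K * A)) $$ (i, j)) = (mat_adjoint A * A) $$ (i, j)"
proof -
  let ?d = "dim_row A"
  have dim: "dim_col K = ?d" if "K \<in> set Ks" for K
    using K that by (auto simp: measurement_def)
  have *: "(\<Sum>K\<leftarrow>Ks. (mat_adjoint K * K) $$ (x, y)) = (if x = y then 1 else 0)"
    if "x < ?d" "y < ?d" for x y
  proof -
    have "(\<Sum>K\<leftarrow>Ks. (mat_adjoint K * K) $$ (x, y)) =
        mat_sum ?d (map (\<lambda>K. mat_adjoint K * K) Ks) $$ (x, y)"
      using that dim by (subst mat_sum_index) (auto simp: o_def)
    then show ?thesis using K that by (auto simp: measurement_def)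
  qed
  have "(\<Sum>K\<leftarrow>Ks. (mat_adjoint (K * A) * (K * A)) $$ (i, j)) =
    (\<Sum>K\<leftarrow>Ks. \<Sum>x<?d. \<Sum>y<?d. cnj (A $$ (x, i)) * A $$ (y, j) * (mat_adjoint K * K) $$ (x, y))"
  proof (intro arg_cong[where f = sum_list] map_cong refl, goal_cases)
    case (1 K)
    have "(mat_adjoint (K * A) * (K * A)) $$ (i, j) =
       (\<Sum>k<dim_row K. (\<Sum>x<?d. cnj (K $$ (k, x) * A $$ (x, i))) * (\<Sum>y<?d. K $$ (k, y) * A $$ (y, j)))"
      using i j dim[OF 1]
      by (subst gram_index) (auto simp: scalar_prod_def atLeast0LessThan)
    also have "\<dots> = (\<Sum>k<dim_row K. \<Sum>x<?d. \<Sum>y<?d.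
        cnj (A $$ (x, i)) * A $$ (y, j) * (cnj (K $$ (k, x)) * K $$ (k, y)))"
      unfolding sum_product by (simp add: mult_ac)
    also have "\<dots> = (\<Sum>x<?d. \<Sum>k<dim_row K. \<Sum>y<?d.
        cnj (A $$ (x, i)) * A $$ (y, j) * (cnj (K $$ (k, x)) * K $$ (k, y)))"
      by (rule sum.swap)
    also have "\<dots> = (\<Sum>x<?d. \<Sum>y<?d. \<Sum>k<dim_row K.
        cnj (A $$ (x, i)) * A $$ (y, j) * (cnj (K $$ (k, x)) * K $$ (k, y)))"
      by (rule sum.cong[OF refl]) (rule sum.swap)
    also have "\<dots> = (\<Sum>x<?d. \<Sum>y<?d. cnj (A $$ (x, i)) * A $$ (y, j) * (mat_adjoint K * K) $$ (x, y))"
      using dim[OF 1] by (intro sum.cong refl, subst gram_index) (auto simp: sum_distrib_left)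
    finally show ?case .
  qed
  also have "\<dots> = (\<Sum>x<?d. \<Sum>y<?d. cnj (A $$ (x, i)) * A $$ (y, j) *
      (\<Sum>K\<leftarrow>Ks. (mat_adjoint K * K) $$ (x, y)))"
    by (simp add: sum_list_sum_swap sum_list_const_mult)
  also have "\<dots> = (\<Sum>x<?d. \<Sum>y<?d. if x = y then cnj (A $$ (x, i)) * A $$ (y, j) else 0)"
    by (intro sum.cong refl) (use * in auto)
  also have "\<dots> = (mat_adjoint A * A) $$ (i, j)"
    by (subst gram_index) (use i j in \<open>auto simp: sum.delta\<close>)
  finally show ?thesis .
qed

lemma branches_dim:
  "(h, A, B) \<in> set (branches m n a b r) \<Longrightarrow> dim_col A = m \<and> dim_col B = n"
  by (induction r arbitrary: h A B) auto

lemma psd_gram: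
  assumes "dim_col A = d"
  shows "psd d (mat_adjoint A * A)"
proof -
  have "0 \<le> ((mat_adjoint A * A) *\<^sub>v v) \<bullet>c v" if v: "v \<in> carrier_vec d" for v
  proof -
    have dv: "dim_vec v = d" using v by auto
    have "((mat_adjoint A * A) *\<^sub>v v) \<bullet>c v = (mat_adjoint A *\<^sub>v (A *\<^sub>v v)) \<bullet>c v"
      using v assms by (subst assoc_mult_mat_vec[of _ d "dim_row A" _ d]) auto
    also have "\<dots> = (\<Sum>i<d. \<Sum>k<dim_row A. cnj (A $$ (k, i)) * (A *\<^sub>v v) $ k * cnj (v $ i))"
      using assms dv by (simp add: scalar_prod_def atLeast0LessThan sum_distrib_right)
    also have "\<dots> = (\<Sum>k<dim_row A. (A *\<^sub>v v) $ k * (\<Sum>i<d. cnj (A $$ (k, i)) * cnj (v $ i)))"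
      by (subst sum.swap) (simp add: sum_distrib_left mult_ac)
    also have "\<dots> = (A *\<^sub>v v) \<bullet>c (A *\<^sub>v v)"
      using assms dv by (simp add: scalar_prod_def atLeast0LessThan)
    finally show ?thesis by (simp add: conjugate_square_ge_0_vec)
  qed
  then show ?thesis using assms unfolding psd_def by auto
qed

text \<open>The operators obtained from a protocol do form a POVM.\<close>

lemma locc_povm_povm:
  assumes "locc_povm m n Ms"
  shows "povm (m * n) Ms"
proof -
  obtain r a b where prot: "protocol m n r a b" and
    Ms: "Ms = map (\<lambda>(h, A, B). mat_adjoint (A \<otimes>\<^sub>m B) * (A \<otimes>\<^sub>m B)) (branches m n a b r)"
    using assms unfolding locc_povm_def locc_r_povm_def by auto
  let ?g = "\<lambda>A i j. (mat_adjoint A * (A :: complex mat)) $$ (i, j)"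
  have sum: "(\<Sum>(h, A, B)\<leftarrow>branches m n a b s. ?g A i j * ?g B k l) =
      (if i = j \<and> k = l then 1 else 0)"
    if "i < m" "j < m" "k < n" "l < n" "s \<le> r" for i j k l s
    using that(5)
  proof (induction s)
    case 0
    have "mat_adjoint (1\<^sub>m d) = (1\<^sub>m d :: complex mat)" for d by (intro eq_matI) auto
    then show ?case using that by simp
  next
    case (Suc s)
    have step: "(\<Sum>x\<leftarrow>[0..<length (a h)]. \<Sum>y\<leftarrow>[0..<length (b h x)].
        ?g (a h ! x * A) i j * ?g (b h x ! y * B) k l) = ?g A i j * ?g B k l"
      if hAB: "(h, A, B) \<in> set (branches m n a b s)" for h A B
    proof -
      have *: "(\<Sum>x\<leftarrow>[0..<length xs]. f (xs ! x)) = (\<Sum>x\<leftarrow>xs. f x)"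
        for f :: "complex mat \<Rightarrow> complex" and xs
        by (metis map_nth map_map[unfolded o_def])
      have meas: "measurement (dim_row A) (a h)"
        "\<forall>x < length (a h). measurement (dim_row B) (b h x)"
        using prot[unfolded protocol_def, rule_format, OF _ hAB] Suc.prems by auto
      have dims: "dim_col A = m" "dim_col B = n" using branches_dim[OF hAB] by auto
      have "(\<Sum>x\<leftarrow>[0..<length (a h)]. \<Sum>y\<leftarrow>[0..<length (b h x)].
          ?g (a h ! x * A) i j * ?g (b h x ! y * B) k l) =
        (\<Sum>x\<leftarrow>[0..<length (a h)]. ?g (a h ! x * A) i j * ?g B k l)"
      proof (intro arg_cong[where f = sum_list] map_cong refl, goal_cases)
        case (1 x)
        then have "measurement (dim_row B) (b h x)" using meas by auto
        from measurement_gram[OF this, of k l] show ?case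
          using dims \<open>k < n\<close> \<open>l < n\<close>
          by (simp only: sum_list_const_mult *[of "\<lambda>K. ?g (K * B) k l" "b h x"])
      qed
      also have "\<dots> = ?g A i j * ?g B k l"
        using measurement_gram[OF meas(1), of i j] dims \<open>i < m\<close> \<open>j < m\<close>
        by (simp only: sum_list_mult_const *[of "\<lambda>K. ?g (K * A) i j" "a h"])
      finally show ?thesis .
    qed
    have cc: "sum_list (map f (concat (map g xs))) = (\<Sum>x\<leftarrow>xs. sum_list (map f (g x)))"
      for f :: "history \<times> complex mat \<times> complex mat \<Rightarrow> complex" and g and xs :: "'z list"
      by (induction xs) auto
    have "(\<Sum>(h, A, B)\<leftarrow>branches m n a b (Suc s). ?g A i j * ?g B k l) =
       (\<Sum>(h, A, B)\<leftarrow>branches m n a b s. \<Sum>x\<leftarrow>[0..<length (a h)]. \<Sum>y\<leftarrow>[0..<length (b h x)].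
        ?g (a h ! x * A) i j * ?g (b h x ! y * B) k l)"
      unfolding branches.simps cc
      by (intro arg_cong[where f = sum_list] map_cong refl)
        (auto simp only: cc map_map o_def split: prod.split list.split)
    also have "\<dots> = (\<Sum>(h, A, B)\<leftarrow>branches m n a b s. ?g A i j * ?g B k l)"
      by (intro arg_cong[where f = sum_list] map_cong refl) (clarify, rule step)
    finally show ?case using Suc by simp
  qed
  have psd: "\<forall>M \<in> set Ms. psd (m * n) M"
    unfolding Ms using branches_dim by (auto intro!: psd_gram)
  have "mat_sum (m * n) Ms = 1\<^sub>m (m * n)"
  proof (rule eq_matI)
    fix i j assume "i < dim_row (1\<^sub>m (m * n) :: complex mat)" "j < dim_col (1\<^sub>m (m * n) :: complex mat)"
    then have ij: "i < m * n" "j < m * n" by auto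
    then have n: "0 < n" by (cases n) auto
    have "mat_sum (m * n) Ms $$ (i, j) = (\<Sum>M\<leftarrow>Ms. M $$ (i, j))"
      using psd ij by (intro mat_sum_index) (auto simp: psd_def)
    also have "\<dots> = (\<Sum>(h, A, B)\<leftarrow>branches m n a b r.
        ?g A (i div n) (j div n) * ?g B (i mod n) (j mod n))"
      unfolding Ms map_map
    proof (intro arg_cong[where f = sum_list] map_cong refl, goal_cases)
      case (1 x)
      obtain h A B where x: "x = (h, A, B)" by (cases x)
      then have "dim_col A = m" "dim_col B = n" using branches_dim 1 by auto
      then show ?case using gram_tensor_index[of i A B j] ij by (simp add: x)
    qed
    also have "\<dots> = (if i div n = j div n \<and> i mod n = j mod n then 1 else 0)"
      using ij n by (intro sum) (auto simp: less_mult_imp_div_less)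
    also have "i div n = j div n \<and> i mod n = j mod n \<longleftrightarrow> i = j"
      by (metis div_mult_mod_eq)
    finally show "mat_sum (m * n) Ms $$ (i, j) = 1\<^sub>m (m * n) $$ (i, j)"
      using ij by simp
  qed (use mat_sum_dim[of Ms "m * n"] psd in \<open>auto simp: psd_def\<close>)
  with psd show ?thesis by (simp add: povm_def)
qed

definition locc_distinguishable :: "nat \<Rightarrow> nat \<Rightarrow> complex mat set \<Rightarrow> bool"
  where "locc_distinguishable m n S \<longleftrightarrow>
    (\<exists>Ms. locc_povm m n Ms \<and>
      (\<forall>M \<in> set Ms. \<forall>\<rho> \<in> S. \<forall>\<sigma> \<in> S.
        mat_trace (M * \<rho>) \<noteq> 0 \<and> mat_trace (M * \<sigma>) \<noteq> 0 \<longrightarrow> \<rho> = \<sigma>))"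

abbreviation locc_indistinguishable :: "nat \<Rightarrow> nat \<Rightarrow> complex mat set \<Rightarrow> bool"
  where "locc_indistinguishable m n S \<equiv> \<not> locc_distinguishable m n S"


section \<open>The Domino states and their extension\<close>

definition domino_states :: "nat \<Rightarrow> nat \<Rightarrow> complex vec set"
  where "domino_states m n =
    (let e = unit_vec m; f = unit_vec n in
     {e 0 \<otimes>\<^sub>v (f 0 + f 1), e 0 \<otimes>\<^sub>v (f 0 - f 1),
      (e 0 + e 1) \<otimes>\<^sub>v f 2, (e 0 - e 1) \<otimes>\<^sub>v f 2,
      e 2 \<otimes>\<^sub>v (f 1 + f 2), e 2 \<otimes>\<^sub>v (f 1 - f 2),
      (e 1 + e 2) \<otimes>\<^sub>v f 0, (e 1 - e 2) \<otimes>\<^sub>v f 0,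
      e 1 \<otimes>\<^sub>v f 1})"

text \<open>The added vectors are the computational basis vectors outside the 3 by 3 block spanned by the
  Domino states, that is, those with at least one label not among 0, 1, 2. (Taking only those with
  both labels at least 3 would give a complete basis just for m = n = 3.)\<close>

definition extension_states :: "nat \<Rightarrow> nat \<Rightarrow> complex vec set"
  where "extension_states m n =
    {unit_vec m i \<otimes>\<^sub>v unit_vec n j | i j. i < m \<and> j < n \<and> (3 \<le> i \<or> 3 \<le> j)}"

definition extended_domino_basis :: "nat \<Rightarrow> nat \<Rightarrow> complex vec set"
  where "extended_domino_basis m n = domino_states m n \<union> extension_states m n"

end

theory Submission
  imports Defs
begin

text \<open>If the leaves of a protocol discriminate the states, then every branch \<open>(A, B)\<close> of it maps
  orthogonal states to orthogonal vectors: the inner product of two images under \<open>A \<otimes> B\<close> is the sum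
  of the inner products over the outcomes of the next measurement, and at a leaf one of the two images
  vanishes. For the Domino states, preservation of orthogonality is rigid: if B is a nonzero
  multiple of an isometry on the span of the first three basis vectors, then A is a multiple of an
  isometry there too, and conversely. Starting from the identity and choosing at each measurement an
  outcome of nonzero probability, one arrives at a leaf that annihilates no Domino state, a
  contradiction.\<close>


section \<open>Product vectors\<close>

lemma dim_tensor_vec [simp]: "dim_vec (u \<otimes>\<^sub>v v) = dim_vec u * dim_vec v"
  by (simp add: tensor_vec_def)

lemma tensor_vec_carrier [simp]:
  "u \<in> carrier_vec m \<Longrightarrow> v \<in> carrier_vec n \<Longrightarrow> u \<otimes>\<^sub>v v \<in> carrier_vec (m * n)"
  by (intro carrier_vecI) (simp add: carrier_vecD)

lemma tensor_index_less:
  fixes x p y q :: nat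
  assumes "x < p" "y < q"
  shows "x * q + y < p * q"
proof -
  have "x * q + y < (x + 1) * q" using assms by simp
  also have "\<dots> \<le> p * q" using assms by (intro mult_right_mono) auto
  finally show ?thesis .
qed

lemma tensor_vec_index:
  assumes "x < dim_vec u" "y < q" "dim_vec v = q"
  shows "(u \<otimes>\<^sub>v v) $ (x * q + y) = u $ x * v $ y"
  using assms tensor_index_less[of x "dim_vec u" y q] by (simp add: tensor_vec_def)

lemma tensor_index_bounds:
  fixes i p q :: nat
  assumes "i < p * q"
  shows "i div q < p" "i mod q < q"
proof -
  have "q > 0" using assms by (cases q) auto
  then show "i div q < p" "i mod q < q" using assms by (auto simp: less_mult_imp_div_less)
qed

lemma tensor_vec_distribs:
  assumes "dim_vec u = dim_vec u'"
  shows "(u + u') \<otimes>\<^sub>v v = u \<otimes>\<^sub>v v + u' \<otimes>\<^sub>v v" "(u - u') \<otimes>\<^sub>v v = u \<otimes>\<^sub>v v - u' \<otimes>\<^sub>v v"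
    and "v \<otimes>\<^sub>v (u + u') = v \<otimes>\<^sub>v u + v \<otimes>\<^sub>v u'" "v \<otimes>\<^sub>v (u - u') = v \<otimes>\<^sub>v u - v \<otimes>\<^sub>v u'"
proof -
  have mod: "i mod dim_vec u' < dim_vec u'" if "i < dim_vec v * dim_vec u'" for i
    using tensor_index_bounds(2)[OF that] .
  show "(u + u') \<otimes>\<^sub>v v = u \<otimes>\<^sub>v v + u' \<otimes>\<^sub>v v" "(u - u') \<otimes>\<^sub>v v = u \<otimes>\<^sub>v v - u' \<otimes>\<^sub>v v"
    using assms by (auto intro!: eq_vecI simp: tensor_vec_def tensor_index_bounds ring_distribs)
  show "v \<otimes>\<^sub>v (u + u') = v \<otimes>\<^sub>v u + v \<otimes>\<^sub>v u'" "v \<otimes>\<^sub>v (u - u') = v \<otimes>\<^sub>v u - v \<otimes>\<^sub>v u'"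
    using assms by (auto intro!: eq_vecI simp: tensor_vec_def mod ring_distribs)
qed

lemma tensor_unit_vec:
  assumes "i < m" "j < n"
  shows "unit_vec m i \<otimes>\<^sub>v unit_vec n j = unit_vec (m * n) (i * n + j)"
proof (rule eq_vecI)
  fix k assume "k < dim_vec (unit_vec (m * n) (i * n + j) :: complex vec)"
  then have k: "k < m * n" by simp
  have "k = i * n + j \<longleftrightarrow> k div n = i \<and> k mod n = j"
    using assms by auto
  then show "(unit_vec m i \<otimes>\<^sub>v unit_vec n j) $ k = unit_vec (m * n) (i * n + j) $ k"
    using k assms tensor_index_bounds[OF k] tensor_index_less[OF assms]
    by (auto simp: tensor_vec_def)
qed simp

section \<open>Inner products and traces for product states\<close>

lemma cscalar_prod_sum: "dim_vec u = dim_vec v \<Longrightarrow> u \<bullet>c v = (\<Sum>i<dim_vec u. u $ i * cnj (v $ i))"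
  by (simp add: scalar_prod_def atLeast0LessThan)

lemma cscalar_prod_distribs:
  fixes u v w :: "complex vec"
  assumes "dim_vec u = dim_vec w" "dim_vec v = dim_vec w"
  shows "(u + v) \<bullet>c w = u \<bullet>c w + v \<bullet>c w" "(u - v) \<bullet>c w = u \<bullet>c w - v \<bullet>c w"
    and "w \<bullet>c (u + v) = w \<bullet>c u + w \<bullet>c v" "w \<bullet>c (u - v) = w \<bullet>c u - w \<bullet>c v"
  using assms by (auto simp: cscalar_prod_sum sum.distrib sum_subtractf algebra_simps)

lemma cscalar_prod_commute:
  fixes u v :: "complex vec"
  assumes "dim_vec u = dim_vec v"
  shows "v \<bullet>c u = cnj (u \<bullet>c v)"
  using assms by (simp add: cscalar_prod_sum mult.commute)

lemma cscalar_prod_unit_vec: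
  assumes "i < d" "j < d"
  shows "unit_vec d i \<bullet>c unit_vec d j = (if i = j then 1 else 0 :: complex)"
  using assms by simp

text \<open>Summing over indices \<open>x * dim_vec v' + y\<close> splits into a double sum that
  factors. Orthogonality of product states thus becomes the vanishing of one of two local inner
  products.\<close>

lemma cscalar_prod_tensor_vec:
  assumes "dim_vec u = dim_vec u'" "dim_vec v = dim_vec v'"
  shows "(u \<otimes>\<^sub>v v) \<bullet>c (u' \<otimes>\<^sub>v v') = (u \<bullet>c u') * (v \<bullet>c v')"
proof -
  have "(u \<otimes>\<^sub>v v) \<bullet>c (u' \<otimes>\<^sub>v v') = (\<Sum>x<dim_vec u'. \<Sum>y<dim_vec v'.
      (u \<otimes>\<^sub>v v) $ (x * dim_vec v' + y) * cnj ((u' \<otimes>\<^sub>v v') $ (x * dim_vec v' + y)))"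
    by (simp add: cscalar_prod_sum sum_lessThan_mult assms)
  also have "\<dots> = (\<Sum>x<dim_vec u'. \<Sum>y<dim_vec v'. (u $ x * cnj (u' $ x)) * (v $ y * cnj (v' $ y)))"
    by (intro sum.cong refl) (use assms in \<open>simp add: tensor_vec_index\<close>)
  also have "\<dots> = (u \<bullet>c u') * (v \<bullet>c v')"
    by (simp add: cscalar_prod_sum sum_product assms)
  finally show ?thesis .
qed

lemma tensor_mat_mult_vec:
  assumes "dim_vec u = dim_col A" "dim_vec v = dim_col B"
  shows "(A \<otimes>\<^sub>m B) *\<^sub>v (u \<otimes>\<^sub>v v) = (A *\<^sub>v u) \<otimes>\<^sub>v (B *\<^sub>v v)"
proof (rule eq_vecI)
  fix i assume "i < dim_vec ((A *\<^sub>v u) \<otimes>\<^sub>v (B *\<^sub>v v))"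
  then have i: "i < dim_row A * dim_row B" by simp
  have "((A \<otimes>\<^sub>m B) *\<^sub>v (u \<otimes>\<^sub>v v)) $ i =
      (\<Sum>k<dim_col A * dim_col B. (A \<otimes>\<^sub>m B) $$ (i, k) * (u \<otimes>\<^sub>v v) $ k)"
    using i assms by (simp add: scalar_prod_def atLeast0LessThan)
  also have "\<dots> = (\<Sum>x<dim_col A. \<Sum>y<dim_col B.
      (A $$ (i div dim_row B, x) * u $ x) * (B $$ (i mod dim_row B, y) * v $ y))"
    unfolding sum_lessThan_mult
    by (intro sum.cong refl)
      (use assms i in \<open>auto simp: tensor_mat_def tensor_index_less tensor_vec_index\<close>)
  also have "\<dots> = ((A *\<^sub>v u) \<otimes>\<^sub>v (B *\<^sub>v v)) $ i"
    using i assms tensor_index_bounds[OF i]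
    by (simp add: tensor_vec_def scalar_prod_def atLeast0LessThan sum_product)
  finally show "((A \<otimes>\<^sub>m B) *\<^sub>v (u \<otimes>\<^sub>v v)) $ i = ((A *\<^sub>v u) \<otimes>\<^sub>v (B *\<^sub>v v)) $ i" .
qed simp

text \<open>Cyclicity of the trace, carried out as a reordering of a triple sum. It turns a nonzero
  trace in the definition of distinguishability into the statement that \<open>K\<close> does not
  annihilate the state.\<close>

lemma mat_trace_gram_density:
  assumes "dim_col K = dim_vec \<psi>"
  shows "mat_trace (mat_adjoint K * K * density \<psi>) = ((K *\<^sub>v \<psi>) \<bullet>c (K *\<^sub>v \<psi>)) / (\<psi> \<bullet>c \<psi>)"
proof -
  let ?d = "dim_vec \<psi>"
  have "mat_trace (mat_adjoint K * K * density \<psi>) =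
     (\<Sum>i<?d. \<Sum>j<?d. (\<Sum>k<dim_row K. cnj (K $$ (k, i)) * K $$ (k, j)) * (\<psi> $ j * cnj (\<psi> $ i) / (\<psi> \<bullet>c \<psi>)))"
    using assms unfolding mat_trace_def
    by (simp add: scalar_prod_def atLeast0LessThan density_def)
  also have "\<dots> = (\<Sum>i<?d. \<Sum>j<?d. \<Sum>k<dim_row K. (K $$ (k, j) * \<psi> $ j) * cnj (K $$ (k, i) * \<psi> $ i)) / (\<psi> \<bullet>c \<psi>)"
    by (simp add: sum_distrib_right sum_distrib_left sum_divide_distrib mult_ac)
  \<comment> \<open>Three swaps bring \<open>k\<close> outermost and \<open>j\<close> before
    \<open>i\<close>, so that each summand over \<open>k\<close> is entry \<open>k\<close> of
    \<open>K *\<^sub>v \<psi>\<close> times its conjugate.\<close>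
  also have "(\<Sum>i<?d. \<Sum>j<?d. \<Sum>k<dim_row K. (K $$ (k, j) * \<psi> $ j) * cnj (K $$ (k, i) * \<psi> $ i)) =
     (\<Sum>i<?d. \<Sum>k<dim_row K. \<Sum>j<?d. (K $$ (k, j) * \<psi> $ j) * cnj (K $$ (k, i) * \<psi> $ i))"
    by (intro sum.cong refl sum.swap)
  also have "\<dots> = (\<Sum>k<dim_row K. \<Sum>i<?d. \<Sum>j<?d. (K $$ (k, j) * \<psi> $ j) * cnj (K $$ (k, i) * \<psi> $ i))"
    by (rule sum.swap)
  also have "\<dots> = (\<Sum>k<dim_row K. \<Sum>j<?d. \<Sum>i<?d. (K $$ (k, j) * \<psi> $ j) * cnj (K $$ (k, i) * \<psi> $ i))"
    by (intro sum.cong refl sum.swap)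
  also have "\<dots> = (K *\<^sub>v \<psi>) \<bullet>c (K *\<^sub>v \<psi>)"
    using assms by (simp add: cscalar_prod_sum scalar_prod_def atLeast0LessThan sum_product)
  finally show ?thesis .
qed

text \<open>Apply both operators to \<open>\<psi>\<close>: \<open>density \<phi>\<close> sends it to
  zero by orthogonality, while \<open>density \<psi>\<close> fixes it. This excludes the case
  \<open>\<rho> = \<sigma>\<close> that the definition of distinguishability permits.\<close>

lemma density_neq:
  assumes dim: "dim_vec \<phi> = dim_vec \<psi>" and orth: "\<psi> \<bullet>c \<phi> = 0" and "\<psi> \<bullet>c \<psi> \<noteq> 0"
  shows "density \<phi> \<noteq> density \<psi>"
proof
  assume eq: "density \<phi> = density \<psi>"
  let ?d = "dim_vec \<psi>"
  have apply_density: "(\<Sum>j<?d. density \<chi> $$ (i, j) * \<psi> $ j) = \<chi> $ i * (\<psi> \<bullet>c \<chi>) / (\<chi> \<bullet>c \<chi>)"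
    if "dim_vec \<chi> = ?d" "i < ?d" for \<chi> i
    using that by (simp add: density_def cscalar_prod_sum sum_divide_distrib sum_distrib_left
        sum_distrib_right mult_ac)
  have "\<psi> $ i = 0" if "i < ?d" for i
    using apply_density[OF dim that] apply_density[OF refl that] eq orth assms(3) by simp
  then show False using assms(3) by (simp add: cscalar_prod_sum)
qed


section \<open>Preservation of orthogonality along a protocol\<close>

text \<open>A measurement as a whole is an isometry, so inner products, and not only norms, are
  distributed over the outcomes. This is \<open>measurement_gram\<close> for a matrix with just two
  columns.\<close>

lemma measurement_isometry:
  assumes meas: "measurement d Ks" and dims: "dim_vec x = d" "dim_vec y = d"
  shows "(\<Sum>K\<leftarrow>Ks. (K *\<^sub>v x) \<bullet>c (K *\<^sub>v y)) = x \<bullet>c y"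
proof -
  \<comment> \<open>The column \<open>y\<close> comes first because entry (0, 1) of a Gram matrix
    conjugates column 0, whereas \<open>\<bullet>c\<close> conjugates its second argument.\<close>
  define A where "A = mat_of_cols d [y, x]"
  have A: "dim_row A = d" "dim_col A = 2" by (auto simp: A_def)
  have cols: "A $$ (k, 0) = y $ k" "A $$ (k, 1) = x $ k" if "k < d" for k
    using that by (auto simp: A_def mat_of_cols_def)
  have gram: "(mat_adjoint (K * A) * (K * A)) $$ (0, 1) = (K *\<^sub>v x) \<bullet>c (K *\<^sub>v y)"
    if "dim_col K = d" for K
  proof -
    have "(K * A) $$ (k, 0) = (K *\<^sub>v y) $ k" "(K * A) $$ (k, 1) = (K *\<^sub>v x) $ k"
      if "k < dim_row K" for k
      using that \<open>dim_col K = d\<close> A dims cols by (auto simp: scalar_prod_def)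
    then show ?thesis
      using that A by (subst gram_index) (auto simp: cscalar_prod_sum mult.commute)
  qed
  have "(\<Sum>K\<leftarrow>Ks. (K *\<^sub>v x) \<bullet>c (K *\<^sub>v y)) = (\<Sum>K\<leftarrow>Ks. (mat_adjoint (K * A) * (K * A)) $$ (0, 1))"
    by (intro arg_cong[where f = sum_list] map_cong refl, subst gram)
      (use meas in \<open>auto simp: measurement_def\<close>)
  also have "\<dots> = (mat_adjoint A * A) $$ (0, 1)"
    by (rule measurement_gram) (use meas A in auto)
  also have "\<dots> = x \<bullet>c y"
    using A cols dims by (subst gram_index) (auto simp: cscalar_prod_sum mult.commute)
  finally show ?thesis .
qed


lemma sum_list_nth_0:
  fixes f :: "'b \<Rightarrow> 'a :: comm_monoid_add"
  assumes "(\<Sum>x\<leftarrow>xs. f x) \<noteq> 0"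
  obtains k where "k < length xs" "f (xs ! k) \<noteq> 0"
proof -
  have "\<exists>x \<in> set xs. f x \<noteq> 0"
    using assms by (induction xs) auto
  then show ?thesis using that by (metis in_set_conv_nth)
qed

lemma measurement_isometry_mult:
  assumes "measurement (dim_row A) Ks" "dim_vec x = dim_col A" "dim_vec y = dim_col A"
  shows "(\<Sum>K\<leftarrow>Ks. ((K * A) *\<^sub>v x) \<bullet>c ((K * A) *\<^sub>v y)) = (A *\<^sub>v x) \<bullet>c (A *\<^sub>v y)"
proof -
  have "(K * A) *\<^sub>v z = K *\<^sub>v (A *\<^sub>v z)" if "K \<in> set Ks" "dim_vec z = dim_col A" for K z
    using assms(1) that
    by (intro assoc_mult_mat_vec[of _ "dim_row K" "dim_row A" _ "dim_col A"])
      (auto simp: measurement_def intro: carrier_matI carrier_vecI)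
  then have "(\<Sum>K\<leftarrow>Ks. ((K * A) *\<^sub>v x) \<bullet>c ((K * A) *\<^sub>v y)) =
      (\<Sum>K\<leftarrow>Ks. (K *\<^sub>v (A *\<^sub>v x)) \<bullet>c (K *\<^sub>v (A *\<^sub>v y)))"
    using assms by (intro arg_cong[where f = sum_list] map_cong refl) simp
  also have "\<dots> = (A *\<^sub>v x) \<bullet>c (A *\<^sub>v y)"
    using assms by (intro measurement_isometry) auto
  finally show ?thesis .
qed

text \<open>For matching dimensions the product is the inner product of the images of two product
  vectors under \<open>A \<otimes>\<^sub>m B\<close>. In factored form, a measurement by one party
  touches one factor only.\<close>

definition keeps_orthogonal ::
    "complex mat \<Rightarrow> complex mat \<Rightarrow> complex vec \<times> complex vec \<Rightarrow> complex vec \<times> complex vec \<Rightarrow> bool"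
  where "keeps_orthogonal A B p q \<longleftrightarrow>
    ((A *\<^sub>v fst p) \<bullet>c (A *\<^sub>v fst q)) * ((B *\<^sub>v snd p) \<bullet>c (B *\<^sub>v snd q)) = 0"

text \<open>Information flows backwards: if the product were nonzero before a measurement, the
  measuring party's factor, being a sum over outcomes, would be nonzero for some outcome, while the
  other factor has not changed.\<close>

lemma keeps_orthogonal_before_measurement:
  assumes "dim_vec (fst p) = dim_col A" "dim_vec (fst q) = dim_col A"
    and "dim_vec (snd p) = dim_col B" "dim_vec (snd q) = dim_col B"
  shows "measurement (dim_row A) Ks \<Longrightarrow> (\<And>k. k < length Ks \<Longrightarrow> keeps_orthogonal (Ks ! k * A) B p q) \<Longrightarrow>
      keeps_orthogonal A B p q"
    and "measurement (dim_row B) Ls \<Longrightarrow> (\<And>l. l < length Ls \<Longrightarrow> keeps_orthogonal A (Ls ! l * B) p q) \<Longrightarrow>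
      keeps_orthogonal A B p q"
proof -
  show "keeps_orthogonal A B p q" if meas: "measurement (dim_row A) Ks"
    and keeps: "\<And>k. k < length Ks \<Longrightarrow> keeps_orthogonal (Ks ! k * A) B p q"
  proof (rule ccontr)
    assume "\<not> keeps_orthogonal A B p q"
    then have A: "(A *\<^sub>v fst p) \<bullet>c (A *\<^sub>v fst q) \<noteq> 0" and B: "(B *\<^sub>v snd p) \<bullet>c (B *\<^sub>v snd q) \<noteq> 0"
      by (auto simp: keeps_orthogonal_def)
    from A have "(\<Sum>K\<leftarrow>Ks. ((K * A) *\<^sub>v fst p) \<bullet>c ((K * A) *\<^sub>v fst q)) \<noteq> 0"
      using measurement_isometry_mult[OF meas] assms by simp
    then obtain k where "k < length Ks" "((Ks ! k * A) *\<^sub>v fst p) \<bullet>c ((Ks ! k * A) *\<^sub>v fst q) \<noteq> 0"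
      by (rule sum_list_nth_0)
    then show False using keeps B by (auto simp: keeps_orthogonal_def)
  qed
  show "keeps_orthogonal A B p q" if meas: "measurement (dim_row B) Ls"
    and keeps: "\<And>l. l < length Ls \<Longrightarrow> keeps_orthogonal A (Ls ! l * B) p q"
  proof (rule ccontr)
    assume "\<not> keeps_orthogonal A B p q"
    then have A: "(A *\<^sub>v fst p) \<bullet>c (A *\<^sub>v fst q) \<noteq> 0" and B: "(B *\<^sub>v snd p) \<bullet>c (B *\<^sub>v snd q) \<noteq> 0"
      by (auto simp: keeps_orthogonal_def)
    from B have "(\<Sum>L\<leftarrow>Ls. ((L * B) *\<^sub>v snd p) \<bullet>c ((L * B) *\<^sub>v snd q)) \<noteq> 0"
      using measurement_isometry_mult[OF meas] assms by simp
    then obtain l where "l < length Ls" "((Ls ! l * B) *\<^sub>v snd p) \<bullet>c ((Ls ! l * B) *\<^sub>v snd q) \<noteq> 0"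
      by (rule sum_list_nth_0)
    then show False using keeps A by (auto simp: keeps_orthogonal_def)
  qed
qed

lemma branches_SucI:
  assumes "(h, A, B) \<in> set (branches m n a b s)" "k < length (a h)" "l < length (b h k)"
  shows "(h @ [(k, l)], (a h ! k) * A, (b h k ! l) * B) \<in> set (branches m n a b (Suc s))"
  using assms by (auto intro!: bexI[of _ "(h, A, B)"] bexI[of _ k])

lemma protocolD:
  assumes "protocol m n r a b" "s < r" "(h, A, B) \<in> set (branches m n a b s)"
  shows "measurement (dim_row A) (a h)" "k < length (a h) \<Longrightarrow> measurement (dim_row B) (b h k)"
  using assms unfolding protocol_def by fastforce+

lemma keeps_orthogonal_branches:
  assumes prot: "protocol m n r a b" and s: "s \<le> r"
    and dims: "dim_vec (fst p) = m" "dim_vec (fst q) = m" "dim_vec (snd p) = n" "dim_vec (snd q) = n"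
    and leaf: "\<And>h A B. (h, A, B) \<in> set (branches m n a b r) \<Longrightarrow> keeps_orthogonal A B p q"
    and "(h, A, B) \<in> set (branches m n a b s)"
  shows "keeps_orthogonal A B p q"
  using s assms(8)
\<comment> \<open>Downward induction, from the leaves at depth \<open>r\<close> to depth
  \<open>s\<close>.\<close>
proof (induction s arbitrary: h A B rule: inc_induct)
  case (step s)
  note cols = branches_dim[OF step.prems]
  note meas = protocolD[OF prot step.hyps(2) step.prems]
  \<comment> \<open>One round contains two measurements, so the backward step is applied twice: over
    the outcomes of the first party, then over those of the second.\<close>
  show ?case
  proof (rule keeps_orthogonal_before_measurement(1)[OF _ _ _ _ meas(1)])
    fix k assume k: "k < length (a h)"
    show "keeps_orthogonal (a h ! k * A) B p q"
      by (rule keeps_orthogonal_before_measurement(2)[OF _ _ _ _ meas(2)[OF k]])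
        (use dims cols k step.IH[OF branches_SucI[where a = a and b = b, OF step.prems]] in auto)
  qed (use dims cols in auto)
qed (rule leaf)

text \<open>In the middle of a round, with only the first party having measured, the pair of
  operators is not an entry of \<open>branches\<close>. The rigidity argument needs it too, as it
  alternates between the parties.\<close>

lemma keeps_orthogonal_measured_branch:
  assumes prot: "protocol m n r a b" and s: "s < r"
    and dims: "dim_vec (fst p) = m" "dim_vec (fst q) = m" "dim_vec (snd p) = n" "dim_vec (snd q) = n"
    and leaf: "\<And>h A B. (h, A, B) \<in> set (branches m n a b r) \<Longrightarrow> keeps_orthogonal A B p q"
    and branch: "(h, A, B) \<in> set (branches m n a b s)" and k: "k < length (a h)"
  shows "keeps_orthogonal (a h ! k * A) B p q"
proof (rule keeps_orthogonal_before_measurement(2)[OF _ _ _ _ protocolD(2)[OF prot s branch k]])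
  fix l assume "l < length (b h k)"
  then show "keeps_orthogonal (a h ! k * A) (b h k ! l * B) p q"
    by (intro keeps_orthogonal_branches[OF prot Suc_leI[OF s] dims leaf branches_SucI[OF branch k]])
qed (use dims branches_dim[OF branch] in auto)

lemma measurement_outcome_nonzero:
  assumes "measurement (dim_row A) Ks" "dim_vec x = dim_col A" "(A *\<^sub>v x) \<bullet>c (A *\<^sub>v x) \<noteq> 0"
  obtains k where "k < length Ks" "((Ks ! k * A) *\<^sub>v x) \<bullet>c ((Ks ! k * A) *\<^sub>v x) \<noteq> 0"
  using assms sum_list_nth_0[of "\<lambda>K. ((K * A) *\<^sub>v x) \<bullet>c ((K * A) *\<^sub>v x)" Ks]
  by (auto simp: measurement_isometry_mult)


section \<open>Rigidity of the Domino states\<close>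

text \<open>The Gram matrix of the images of the first three basis vectors is a nonzero multiple of
  the identity. The Domino factors involve only these three vectors.\<close>

definition conformal :: "nat \<Rightarrow> complex mat \<Rightarrow> bool"
  where "conformal d A \<longleftrightarrow> dim_col A = d \<and> (\<exists>c. c \<noteq> 0 \<and> (\<forall>i<3. \<forall>j<3.
    (A *\<^sub>v unit_vec d i) \<bullet>c (A *\<^sub>v unit_vec d j) = (if i = j then c else 0)))"

lemma mult_mat_vec_distribs:
  fixes A :: "complex mat"
  assumes "dim_vec u = dim_col A" "dim_vec v = dim_col A"
  shows "A *\<^sub>v (u + v) = A *\<^sub>v u + A *\<^sub>v v" "A *\<^sub>v (u - v) = A *\<^sub>v u - A *\<^sub>v v"
  using assms mult_add_distrib_mat_vec[of A "dim_row A" "dim_col A" u v]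
    mult_minus_distrib_mat_vec[of A "dim_row A" "dim_col A" u v]
  by (auto intro: carrier_vecI)

lemma conformalI:
  fixes A :: "complex mat"
  defines "e \<equiv> unit_vec (dim_col A)"
  assumes orth: "(A *\<^sub>v e 0) \<bullet>c (A *\<^sub>v e 1) = 0" "(A *\<^sub>v e 2) \<bullet>c (A *\<^sub>v e 1) = 0"
      "(A *\<^sub>v e 0) \<bullet>c (A *\<^sub>v e 2) = 0"
    and norm: "(A *\<^sub>v (e 0 + e 1)) \<bullet>c (A *\<^sub>v (e 0 - e 1)) = 0"
      "(A *\<^sub>v (e 1 + e 2)) \<bullet>c (A *\<^sub>v (e 1 - e 2)) = 0"
    and nz: "(A *\<^sub>v e 0) \<bullet>c (A *\<^sub>v e 0) \<noteq> 0"
  shows "conformal (dim_col A) A"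
proof -
  have dim: "dim_vec (e i) = dim_col A" for i by (simp add: e_def)
  have orth': "(A *\<^sub>v e 1) \<bullet>c (A *\<^sub>v e 0) = 0" "(A *\<^sub>v e 1) \<bullet>c (A *\<^sub>v e 2) = 0"
      "(A *\<^sub>v e 2) \<bullet>c (A *\<^sub>v e 0) = 0"
    using orth cscalar_prod_commute[of "A *\<^sub>v e 0" "A *\<^sub>v e 1"]
      cscalar_prod_commute[of "A *\<^sub>v e 2" "A *\<^sub>v e 1"] cscalar_prod_commute[of "A *\<^sub>v e 0" "A *\<^sub>v e 2"]
    by simp_all
  \<comment> \<open>Once the cross terms vanish, the inner product of the images of a sum and a
    difference is the difference of the two squared norms.\<close>
  have eq: "(A *\<^sub>v e 1) \<bullet>c (A *\<^sub>v e 1) = (A *\<^sub>v e 0) \<bullet>c (A *\<^sub>v e 0)"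
      "(A *\<^sub>v e 2) \<bullet>c (A *\<^sub>v e 2) = (A *\<^sub>v e 0) \<bullet>c (A *\<^sub>v e 0)"
    using norm orth orth' by (simp_all add: mult_mat_vec_distribs cscalar_prod_distribs dim)
  have "i < 3 \<longleftrightarrow> i = 0 \<or> i = 1 \<or> i = 2" for i :: nat by auto
  then have "\<forall>i<3. \<forall>j<3. (A *\<^sub>v e i) \<bullet>c (A *\<^sub>v e j) = (if i = j then (A *\<^sub>v e 0) \<bullet>c (A *\<^sub>v e 0) else 0)"
    using orth orth' eq by auto
  then show ?thesis using nz unfolding conformal_def e_def by blast
qed

text \<open>These are the inner products to be cancelled from products that vanish, and those that
  contradict annihilation at a leaf. With \<open>c\<close> the common squared norm, the last equals
  \<open>2 * c\<close> and all others equal \<open>c\<close>.\<close>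

lemma conformal_nonzero:
  fixes A :: "complex mat"
  assumes "conformal d A"
  defines "e \<equiv> unit_vec d"
  shows "(A *\<^sub>v e 0) \<bullet>c (A *\<^sub>v e 0) \<noteq> 0" "(A *\<^sub>v e 1) \<bullet>c (A *\<^sub>v e 1) \<noteq> 0" "(A *\<^sub>v e 2) \<bullet>c (A *\<^sub>v e 2) \<noteq> 0"
    and "(A *\<^sub>v (e 0 + e 1)) \<bullet>c (A *\<^sub>v e 1) \<noteq> 0" "(A *\<^sub>v (e 1 + e 2)) \<bullet>c (A *\<^sub>v e 1) \<noteq> 0"
    and "(A *\<^sub>v (e 0 + e 1)) \<bullet>c (A *\<^sub>v (e 1 + e 2)) \<noteq> 0"
    and "(A *\<^sub>v (e 0 + e 1)) \<bullet>c (A *\<^sub>v (e 0 + e 1)) \<noteq> 0"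
proof -
  obtain c where c: "c \<noteq> 0" and A: "dim_col A = d"
    and eq: "\<And>i j. i < 3 \<Longrightarrow> j < 3 \<Longrightarrow> (A *\<^sub>v e i) \<bullet>c (A *\<^sub>v e j) = (if i = j then c else 0)"
    using assms unfolding conformal_def by auto
  have dim: "dim_vec (e i) = dim_col A" for i using A by (simp add: e_def)
  show "(A *\<^sub>v e 0) \<bullet>c (A *\<^sub>v e 0) \<noteq> 0" "(A *\<^sub>v e 1) \<bullet>c (A *\<^sub>v e 1) \<noteq> 0" "(A *\<^sub>v e 2) \<bullet>c (A *\<^sub>v e 2) \<noteq> 0"
    "(A *\<^sub>v (e 0 + e 1)) \<bullet>c (A *\<^sub>v e 1) \<noteq> 0" "(A *\<^sub>v (e 1 + e 2)) \<bullet>c (A *\<^sub>v e 1) \<noteq> 0"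
    "(A *\<^sub>v (e 0 + e 1)) \<bullet>c (A *\<^sub>v (e 1 + e 2)) \<noteq> 0"
    "(A *\<^sub>v (e 0 + e 1)) \<bullet>c (A *\<^sub>v (e 0 + e 1)) \<noteq> 0"
    using c by (simp_all add: eq mult_mat_vec_distribs cscalar_prod_distribs dim)
qed

lemma conformal_one_mat:
  assumes "3 \<le> d"
  shows "conformal d (1\<^sub>m d)"
  using assms unfolding conformal_def by (auto simp: cscalar_prod_unit_vec intro!: exI[of _ 1])

text \<open>The pairs are kept apart because the parties act on the factors separately, and a
  product vector determines its factors only up to scalars.\<close>

definition domino_factors :: "nat \<Rightarrow> nat \<Rightarrow> (complex vec \<times> complex vec) set"
  where "domino_factors m n =
    (let e = unit_vec m; f = unit_vec n in
     {(e 0, f 0 + f 1), (e 0, f 0 - f 1), (e 0 + e 1, f 2), (e 0 - e 1, f 2),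
      (e 2, f 1 + f 2), (e 2, f 1 - f 2), (e 1 + e 2, f 0), (e 1 - e 2, f 0), (e 1, f 1)})"

lemma domino_states_factors: "domino_states m n = (\<lambda>(u, v). u \<otimes>\<^sub>v v) ` domino_factors m n"
  by (simp add: domino_states_def domino_factors_def Let_def)

lemma domino_factors_dim:
  "p \<in> domino_factors m n \<Longrightarrow> dim_vec (fst p) = m \<and> dim_vec (snd p) = n"
  by (auto simp: domino_factors_def Let_def)

lemma domino_factors_nonzero:
  assumes "3 \<le> m" "3 \<le> n" "p \<in> domino_factors m n"
  shows "(fst p \<bullet>c fst p) * (snd p \<bullet>c snd p) \<noteq> 0"
  using assms(3) unfolding domino_factors_def Let_def
  by (elim insertE emptyE)
    (use assms(1,2) in \<open>simp_all add: cscalar_prod_distribs cscalar_prod_unit_vec\<close>)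

lemma domino_factors_orthogonal:
  assumes "3 \<le> m" "3 \<le> n" "p \<in> domino_factors m n" "q \<in> domino_factors m n" "p \<noteq> q"
  shows "(fst p \<bullet>c fst q) * (snd p \<bullet>c snd q) = 0"
  using assms(3,4,5) unfolding domino_factors_def Let_def
  by (elim insertE emptyE)
    (use assms(1,2) in \<open>simp_all add: cscalar_prod_distribs cscalar_prod_unit_vec\<close>)

text \<open>Each equation defining \<open>conformal\<close> for one party comes from two Domino states whose
  factors at the other party are not orthogonal.\<close>

lemma domino_conformal:
  fixes A B :: "complex mat"
  assumes mn: "3 \<le> m" "3 \<le> n"
    and keeps: "\<And>p q. p \<in> domino_factors m n \<Longrightarrow> q \<in> domino_factors m n \<Longrightarrow>
      (fst p \<bullet>c fst q) * (snd p \<bullet>c snd q) = 0 \<Longrightarrow> keeps_orthogonal A B p q"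
    and dims: "dim_col A = m" "dim_col B = n"
  shows "conformal n B \<Longrightarrow> (A *\<^sub>v unit_vec m 0) \<bullet>c (A *\<^sub>v unit_vec m 0) \<noteq> 0 \<Longrightarrow> conformal m A"
    and "conformal m A \<Longrightarrow> (B *\<^sub>v unit_vec n 0) \<bullet>c (B *\<^sub>v unit_vec n 0) \<noteq> 0 \<Longrightarrow> conformal n B"
proof -
  define e f :: "nat \<Rightarrow> complex vec" where "e = unit_vec m" and "f = unit_vec n"
  have keeps': "((A *\<^sub>v u) \<bullet>c (A *\<^sub>v u')) * ((B *\<^sub>v v) \<bullet>c (B *\<^sub>v v')) = 0"
    if "(u, v) \<in> domino_factors m n" "(u', v') \<in> domino_factors m n" "(u \<bullet>c u') * (v \<bullet>c v') = 0"
    for u u' v v'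
    using keeps[OF that(1,2)] that(3) by (simp add: keeps_orthogonal_def)
  note simps = domino_factors_def Let_def e_def f_def cscalar_prod_distribs cscalar_prod_unit_vec
  show "conformal m A"
    if B: "conformal n B" and nz: "(A *\<^sub>v unit_vec m 0) \<bullet>c (A *\<^sub>v unit_vec m 0) \<noteq> 0"
  proof -
    note B = conformal_nonzero[OF B, folded f_def]
    have "(A *\<^sub>v e 0) \<bullet>c (A *\<^sub>v e 1) = 0"
      using keeps'[of "e 0" "f 0 + f 1" "e 1" "f 1"] B mn by (simp add: simps)
    moreover have "(A *\<^sub>v e 2) \<bullet>c (A *\<^sub>v e 1) = 0"
      using keeps'[of "e 2" "f 1 + f 2" "e 1" "f 1"] B mn by (simp add: simps)
    moreover have "(A *\<^sub>v e 0) \<bullet>c (A *\<^sub>v e 2) = 0"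
      using keeps'[of "e 0" "f 0 + f 1" "e 2" "f 1 + f 2"] B mn by (simp add: simps)
    moreover have "(A *\<^sub>v (e 0 + e 1)) \<bullet>c (A *\<^sub>v (e 0 - e 1)) = 0"
      using keeps'[of "e 0 + e 1" "f 2" "e 0 - e 1" "f 2"] B mn by (simp add: simps)
    moreover have "(A *\<^sub>v (e 1 + e 2)) \<bullet>c (A *\<^sub>v (e 1 - e 2)) = 0"
      using keeps'[of "e 1 + e 2" "f 0" "e 1 - e 2" "f 0"] B mn by (simp add: simps)
    ultimately show ?thesis
      using conformalI[of A] nz dims by (simp add: e_def)
  qed
  show "conformal n B"
    if A: "conformal m A" and nz: "(B *\<^sub>v unit_vec n 0) \<bullet>c (B *\<^sub>v unit_vec n 0) \<noteq> 0"
  proof -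
    note A = conformal_nonzero[OF A, folded e_def]
    have "(B *\<^sub>v f 0) \<bullet>c (B *\<^sub>v f 1) = 0"
      using keeps'[of "e 1 + e 2" "f 0" "e 1" "f 1"] A mn by (simp add: simps)
    moreover have "(B *\<^sub>v f 2) \<bullet>c (B *\<^sub>v f 1) = 0"
      using keeps'[of "e 0 + e 1" "f 2" "e 1" "f 1"] A mn by (simp add: simps)
    \<comment> \<open>The order is dictated by the factor \<open>(e 0 + e 1, e 1 + e 2)\<close>
      listed in \<open>conformal_nonzero\<close>; conjugation then turns it around for
      \<open>conformalI\<close>.\<close>
    moreover have "(B *\<^sub>v f 2) \<bullet>c (B *\<^sub>v f 0) = 0"
      using keeps'[of "e 0 + e 1" "f 2" "e 1 + e 2" "f 0"] A mn by (simp add: simps)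
    then have "(B *\<^sub>v f 0) \<bullet>c (B *\<^sub>v f 2) = 0"
      using cscalar_prod_commute[of "B *\<^sub>v f 2" "B *\<^sub>v f 0"] by simp
    moreover have "(B *\<^sub>v (f 0 + f 1)) \<bullet>c (B *\<^sub>v (f 0 - f 1)) = 0"
      using keeps'[of "e 0" "f 0 + f 1" "e 0" "f 0 - f 1"] A mn by (simp add: simps)
    moreover have "(B *\<^sub>v (f 1 + f 2)) \<bullet>c (B *\<^sub>v (f 1 - f 2)) = 0"
      using keeps'[of "e 2" "f 1 + f 2" "e 2" "f 1 - f 2"] A mn by (simp add: simps)
    ultimately show ?thesis
      using conformalI[of B] nz dims by (simp add: f_def)
  qed
qed

section \<open>From distinguishability to a contradiction\<close>

text \<open>Orthogonal states have different density operators, so a discriminating POVM element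
  must have trace zero with one of them. That trace is a product of local squared norms divided by
  the nonzero squared norm of the state.\<close>

lemma distinguishing_factors:
  assumes dims: "dim_vec (fst p) = dim_col A" "dim_vec (fst q) = dim_col A"
      "dim_vec (snd p) = dim_col B" "dim_vec (snd q) = dim_col B"
    and orth: "(fst p \<bullet>c fst q) * (snd p \<bullet>c snd q) = 0"
    and nz: "(fst p \<bullet>c fst p) * (snd p \<bullet>c snd p) \<noteq> 0" "(fst q \<bullet>c fst q) * (snd q \<bullet>c snd q) \<noteq> 0"
  defines "M \<equiv> mat_adjoint (A \<otimes>\<^sub>m B) * (A \<otimes>\<^sub>m B)"
    and "\<rho> \<equiv> density (fst p \<otimes>\<^sub>v snd p)" and "\<sigma> \<equiv> density (fst q \<otimes>\<^sub>v snd q)"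
  assumes dist: "mat_trace (M * \<rho>) \<noteq> 0 \<Longrightarrow> mat_trace (M * \<sigma>) \<noteq> 0 \<Longrightarrow> \<rho> = \<sigma>"
  shows "((A *\<^sub>v fst p) \<bullet>c (A *\<^sub>v fst p)) * ((B *\<^sub>v snd p) \<bullet>c (B *\<^sub>v snd p)) = 0 \<or>
    ((A *\<^sub>v fst q) \<bullet>c (A *\<^sub>v fst q)) * ((B *\<^sub>v snd q) \<bullet>c (B *\<^sub>v snd q)) = 0"
proof -
  have "\<sigma> \<noteq> \<rho>"
    unfolding \<rho>_def \<sigma>_def using dims orth nz(1)
    by (intro density_neq) (simp_all add: cscalar_prod_tensor_vec)
  moreover have "mat_trace (M * density (u \<otimes>\<^sub>v v)) =
      ((A *\<^sub>v u) \<bullet>c (A *\<^sub>v u)) * ((B *\<^sub>v v) \<bullet>c (B *\<^sub>v v)) / ((u \<bullet>c u) * (v \<bullet>c v))"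
    if "dim_vec u = dim_col A" "dim_vec v = dim_col B" for u v
    unfolding M_def using that
    by (subst mat_trace_gram_density) (simp_all add: tensor_mat_mult_vec cscalar_prod_tensor_vec)
  ultimately show ?thesis
    using dist nz dims unfolding \<rho>_def \<sigma>_def by auto
qed

text \<open>If a squared norm vanishes, the local image is the zero vector by definiteness, and so
  the corresponding inner product vanishes as well.\<close>

lemma keeps_orthogonalI:
  assumes "((A *\<^sub>v fst p) \<bullet>c (A *\<^sub>v fst p)) * ((B *\<^sub>v snd p) \<bullet>c (B *\<^sub>v snd p)) = 0 \<or>
    ((A *\<^sub>v fst q) \<bullet>c (A *\<^sub>v fst q)) * ((B *\<^sub>v snd q) \<bullet>c (B *\<^sub>v snd q)) = 0"
  shows "keeps_orthogonal A B p q"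
proof -
  have zero: "x \<bullet>c y = 0" if "x \<bullet>c x = 0 \<or> y \<bullet>c y = 0" "dim_vec x = dim_vec y" for x y :: "complex vec"
  proof -
    have x: "x \<in> carrier_vec (dim_vec x)" and y: "y \<in> carrier_vec (dim_vec x)"
      using that(2) by (auto intro: carrier_vecI)
    then have "x = 0\<^sub>v (dim_vec x) \<or> y = 0\<^sub>v (dim_vec x)"
      using that(1) conjugate_square_eq_0_vec by blast
    then show ?thesis
      using x y by (metis carrier_vec_conjugate conjugate_zero_vec scalar_prod_left_zero scalar_prod_right_zero)
  qed
  show ?thesis
    unfolding keeps_orthogonal_def using assms zero[of "A *\<^sub>v fst p" "A *\<^sub>v fst q"]
      zero[of "B *\<^sub>v snd p" "B *\<^sub>v snd q"] by auto
qed

lemma domino_locc_indistinguishable: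
  assumes mn: "3 \<le> m" "3 \<le> n" and S: "domino_states m n \<subseteq> S"
  shows "locc_indistinguishable m n (density ` S)"
proof
  assume "locc_distinguishable m n (density ` S)"
  then obtain Ms where "locc_povm m n Ms" and dist: "\<And>M \<rho> \<sigma>. M \<in> set Ms \<Longrightarrow>
      \<rho> \<in> density ` S \<Longrightarrow> \<sigma> \<in> density ` S \<Longrightarrow> mat_trace (M * \<rho>) \<noteq> 0 \<Longrightarrow> mat_trace (M * \<sigma>) \<noteq> 0 \<Longrightarrow> \<rho> = \<sigma>"
    unfolding locc_distinguishable_def by blast
  then obtain r a b where prot: "protocol m n r a b"
    and Ms: "Ms = map (\<lambda>(h, A, B). mat_adjoint (A \<otimes>\<^sub>m B) * (A \<otimes>\<^sub>m B)) (branches m n a b r)"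
    unfolding locc_povm_def locc_r_povm_def by blast
  let ?D = "domino_factors m n"
  \<comment> \<open>The condition on the pair is orthogonality rather than
    \<open>p \<noteq> q\<close>: it is the hypothesis of \<open>domino_conformal\<close> and makes
    the density operators differ.\<close>
  have leaf: "((A *\<^sub>v fst p) \<bullet>c (A *\<^sub>v fst p)) * ((B *\<^sub>v snd p) \<bullet>c (B *\<^sub>v snd p)) = 0 \<or>
      ((A *\<^sub>v fst q) \<bullet>c (A *\<^sub>v fst q)) * ((B *\<^sub>v snd q) \<bullet>c (B *\<^sub>v snd q)) = 0"
    if branch: "(h, A, B) \<in> set (branches m n a b r)" and pq: "p \<in> ?D" "q \<in> ?D"
      and orth: "(fst p \<bullet>c fst q) * (snd p \<bullet>c snd q) = 0" for h A B p q
  proof (rule distinguishing_factors[OF _ _ _ _ orth])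
    have "mat_adjoint (A \<otimes>\<^sub>m B) * (A \<otimes>\<^sub>m B) \<in> set Ms"
      using branch unfolding Ms set_map by (rule rev_image_eqI) simp
    moreover have "density (fst s \<otimes>\<^sub>v snd s) \<in> density ` S" if "s \<in> ?D" for s
      using that S unfolding domino_states_factors by (auto simp: case_prod_beta)
    ultimately show "density (fst p \<otimes>\<^sub>v snd p) = density (fst q \<otimes>\<^sub>v snd q)"
      if "mat_trace (mat_adjoint (A \<otimes>\<^sub>m B) * (A \<otimes>\<^sub>m B) * density (fst p \<otimes>\<^sub>v snd p)) \<noteq> 0"
        "mat_trace (mat_adjoint (A \<otimes>\<^sub>m B) * (A \<otimes>\<^sub>m B) * density (fst q \<otimes>\<^sub>v snd q)) \<noteq> 0"
      using that pq dist by blast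
  qed (use pq branches_dim[OF branch] domino_factors_dim domino_factors_nonzero[OF mn] in auto)
  have leaf_keeps: "keeps_orthogonal A B p q"
    if "(h, A, B) \<in> set (branches m n a b r)" "p \<in> ?D" "q \<in> ?D"
      "(fst p \<bullet>c fst q) * (snd p \<bullet>c snd q) = 0" for h A B p q
    using keeps_orthogonalI leaf[OF that] by blast
  \<comment> \<open>The path is followed downwards from the root, with both operators conformal at
    the end of every round.\<close>
  have "\<exists>h A B. (h, A, B) \<in> set (branches m n a b s) \<and> conformal m A \<and> conformal n B" if "s \<le> r" for s
    using that
  proof (induction s)
    case 0
    show ?case using mn by (auto simp: conformal_one_mat)
  next
    case (Suc s)
    then obtain h A B where branch: "(h, A, B) \<in> set (branches m n a b s)"
      and A: "conformal m A" and B: "conformal n B" by auto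
    have s: "s < r" using Suc.prems by simp
    note cols = branches_dim[OF branch]
    note meas = protocolD[OF prot s branch]
    \<comment> \<open>The outcome is chosen so that the image of basis vector 0 stays nonzero, which
      is the nondegeneracy that \<open>domino_conformal\<close> asks for.\<close>
    obtain k where k: "k < length (a h)"
      and nzA: "((a h ! k * A) *\<^sub>v unit_vec m 0) \<bullet>c ((a h ! k * A) *\<^sub>v unit_vec m 0) \<noteq> 0"
      using measurement_outcome_nonzero[OF meas(1) _ conformal_nonzero(1)[OF A]] cols by auto
    obtain l where l: "l < length (b h k)"
      and nzB: "((b h k ! l * B) *\<^sub>v unit_vec n 0) \<bullet>c ((b h k ! l * B) *\<^sub>v unit_vec n 0) \<noteq> 0"
      using measurement_outcome_nonzero[OF meas(2)[OF k] _ conformal_nonzero(1)[OF B]] cols by auto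
    note next_branch = branches_SucI[OF branch k l]
    \<comment> \<open>The new operator of the first party is controlled by the old \<open>B\<close>;
      afterwards the new operator of the second party is controlled by this new one.\<close>
    have A': "conformal m (a h ! k * A)"
    proof (rule domino_conformal(1)[OF mn _ _ _ B nzA])
      show "keeps_orthogonal (a h ! k * A) B p q"
        if "p \<in> ?D" "q \<in> ?D" "(fst p \<bullet>c fst q) * (snd p \<bullet>c snd q) = 0" for p q
        by (rule keeps_orthogonal_measured_branch[OF prot s _ _ _ _ leaf_keeps branch k])
          (use that domino_factors_dim in auto)
    qed (use cols in auto)
    have "conformal n (b h k ! l * B)"
    proof (rule domino_conformal(2)[OF mn _ _ _ A' nzB])
      show "keeps_orthogonal (a h ! k * A) (b h k ! l * B) p q"
        if "p \<in> ?D" "q \<in> ?D" "(fst p \<bullet>c fst q) * (snd p \<bullet>c snd q) = 0" for p q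
        by (rule keeps_orthogonal_branches[OF prot Suc.prems _ _ _ _ leaf_keeps next_branch])
          (use that domino_factors_dim in auto)
    qed (use cols in auto)
    with A' next_branch show ?case by blast
  qed
  then obtain h A B where branch: "(h, A, B) \<in> set (branches m n a b r)"
    and A: "conformal m A" and B: "conformal n B" by blast
  \<comment> \<open>The two chosen Domino states are orthogonal at the second party, yet
    conformality lets the leaf annihilate neither.\<close>
  show False
    using leaf[OF branch, of "(unit_vec m 0 + unit_vec m 1, unit_vec n 2)" "(unit_vec m 1, unit_vec n 1)"]
      conformal_nonzero[OF A] conformal_nonzero[OF B] mn
    by (simp add: domino_factors_def Let_def cscalar_prod_distribs cscalar_prod_unit_vec)
qed


section \<open>The extended basis\<close>

definition extended_factors :: "nat \<Rightarrow> nat \<Rightarrow> (complex vec \<times> complex vec) set"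
  where "extended_factors m n = domino_factors m n \<union>
    {(unit_vec m i, unit_vec n j) | i j. i < m \<and> j < n \<and> (3 \<le> i \<or> 3 \<le> j)}"

lemma extended_domino_basis_factors:
  "extended_domino_basis m n = (\<lambda>(u, v). u \<otimes>\<^sub>v v) ` extended_factors m n"
proof -
  have "extension_states m n = (\<lambda>(u, v). u \<otimes>\<^sub>v v) `
      {(unit_vec m i, unit_vec n j) | i j. i < m \<and> j < n \<and> (3 \<le> i \<or> 3 \<le> j)}"
    unfolding extension_states_def
    by (intro subset_antisym subsetI) (auto intro: rev_image_eqI)
  then show ?thesis
    by (simp add: extended_domino_basis_def extended_factors_def domino_states_factors image_Un)
qed

lemma extended_factors_carrier:
  "p \<in> extended_factors m n \<Longrightarrow> fst p \<in> carrier_vec m \<and> snd p \<in> carrier_vec n"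
  using domino_factors_dim[of p m n] by (auto simp: extended_factors_def intro!: carrier_vecI)

lemma extended_factors_nonzero:
  assumes "3 \<le> m" "3 \<le> n" "p \<in> extended_factors m n"
  shows "(fst p \<bullet>c fst p) * (snd p \<bullet>c snd p) \<noteq> 0"
  using assms(3) domino_factors_nonzero[OF assms(1,2), of p]
  by (auto simp: extended_factors_def cscalar_prod_unit_vec)

text \<open>Domino factors are supported on labels 0, 1, 2, so the party whose label is at least 3
  contributes a zero factor.\<close>

lemma domino_extension_orthogonal:
  assumes "3 \<le> m" "3 \<le> n" "p \<in> domino_factors m n" "i < m" "j < n" "3 \<le> i \<or> 3 \<le> j"
  shows "(fst p \<bullet>c unit_vec m i) * (snd p \<bullet>c unit_vec n j) = 0"
  using assms(3) unfolding domino_factors_def Let_def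
  by (elim insertE emptyE)
    (use assms(1,2,4-) in \<open>auto simp: cscalar_prod_distribs cscalar_prod_unit_vec\<close>)

lemma extended_factors_orthogonal:
  assumes mn: "3 \<le> m" "3 \<le> n" and p: "p \<in> extended_factors m n" and q: "q \<in> extended_factors m n"
    and "p \<noteq> q"
  shows "(fst p \<bullet>c fst q) * (snd p \<bullet>c snd q) = 0"
proof -
  note dims = extended_factors_carrier[OF p] extended_factors_carrier[OF q]
  \<comment> \<open>This reduces the case of an extension state followed by a Domino state to the
    opposite order.\<close>
  have commute: "(fst p \<bullet>c fst q) * (snd p \<bullet>c snd q) = cnj ((fst q \<bullet>c fst p) * (snd q \<bullet>c snd p))"
    using dims cscalar_prod_commute[of "fst q" "fst p"] cscalar_prod_commute[of "snd q" "snd p"]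
    by (auto dest!: carrier_vecD)
  consider "p \<in> domino_factors m n" "q \<in> domino_factors m n"
    | i j where "p \<in> domino_factors m n" "q = (unit_vec m i, unit_vec n j)" "i < m" "j < n" "3 \<le> i \<or> 3 \<le> j"
    | i j where "q \<in> domino_factors m n" "p = (unit_vec m i, unit_vec n j)" "i < m" "j < n" "3 \<le> i \<or> 3 \<le> j"
    | i j k l where "p = (unit_vec m i, unit_vec n j)" "q = (unit_vec m k, unit_vec n l)"
      "i < m" "j < n" "k < m" "l < n"
    using p q unfolding extended_factors_def by blast
  then show ?thesis
  proof cases
    case 1
    then show ?thesis using domino_factors_orthogonal[OF mn _ _ \<open>p \<noteq> q\<close>] by blast
  next
    case 2
    then show ?thesis using domino_extension_orthogonal[OF mn] by simp
  next
    case 3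
    then show ?thesis using domino_extension_orthogonal[OF mn, of q i j] unfolding commute by simp
  next
    case 4
    then show ?thesis using \<open>p \<noteq> q\<close> by (auto simp: cscalar_prod_unit_vec)
  qed
qed

section \<open>Orthogonal spanning sets and the span of the extended Domino states\<close>

lemma orthogonal_spanning_imp_basis:
  assumes S: "S \<subseteq> carrier_vec d"
    and orth: "\<And>u v. u \<in> S \<Longrightarrow> v \<in> S \<Longrightarrow> u \<noteq> v \<Longrightarrow> u \<bullet>c v = 0"
    and nz: "\<And>u. u \<in> S \<Longrightarrow> u \<bullet>c u \<noteq> 0"
    and span: "\<And>i. i < d \<Longrightarrow>
      unit_vec d i \<in> LinearCombinations.module.span class_ring (module_vec TYPE(complex) d) S"
  shows "vectorspace.basis class_ring (module_vec TYPE(complex) d) S"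
proof -
  interpret vec_space "TYPE(complex)" d .
  have "\<not> lin_dep S"
  proof
    assume "lin_dep S"
    then obtain T a v where T: "finite T" "T \<subseteq> S" and 0: "lincomb a T = 0\<^sub>v d"
      and v: "v \<in> T" "a v \<noteq> 0"
      unfolding lin_dep_def by auto
    have carrier: "u \<in> carrier_vec d" if "u \<in> T" for u using that T S by auto
    \<comment> \<open>Pairing the vanishing combination with a vector \<open>v\<close> of nonzero
      coefficient leaves only the term \<open>a v * (v \<bullet>c v)\<close>.\<close>
    have "0 = lincomb a T \<bullet>c v" using 0 carrier[OF v(1)] by simp
    also have "\<dots> = (\<Sum>u\<in>T. (a u \<cdot>\<^sub>v u) \<bullet>c v)"
      unfolding lincomb_def by (rule finsum_scalar_prod_sum) (use carrier v in auto)
    also have "\<dots> = (\<Sum>u\<in>T. if u = v then a v * (v \<bullet>c v) else 0)"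
    proof (intro sum.cong refl)
      fix u assume "u \<in> T"
      then have "(a u \<cdot>\<^sub>v u) \<bullet>c v = a u * (u \<bullet>c v)"
        using carrier v(1) by (intro smult_scalar_prod_distrib) auto
      then show "(a u \<cdot>\<^sub>v u) \<bullet>c v = (if u = v then a v * (v \<bullet>c v) else 0)"
        using orth[of u v] T(2) v(1) \<open>u \<in> T\<close> by auto
    qed
    also have "\<dots> = a v * (v \<bullet>c v)" using T(1) v(1) by simp
    finally show False using v T nz by auto
  qed
  moreover have "span S = carrier_vec d"
  proof
    show "span S \<subseteq> carrier_vec d" using span_is_subset2[of S] S by simp
    have "set (unit_vecs d) \<subseteq> span S"
      unfolding unit_vecs_def set_map by (intro image_subsetI span) simp
    from span_subsetI[OF S this] show "carrier_vec d \<subseteq> span S"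
      by (simp only: span_unit_vecs_is_carrier)
  qed
  ultimately show ?thesis using S by (simp add: basis_def)
qed

text \<open>\<open>x\<close> is half the sum of \<open>x + y\<close> and \<open>x - y\<close>, and
  \<open>y\<close> is then \<open>x + y\<close> minus \<open>x\<close>. Each plus-minus pair of
  Domino states is resolved into its two computational basis vectors this way.\<close>

lemma (in vec_space) span_add_diff_cancel:
  fixes x y :: "'a vec"
  assumes "(2 :: 'a) \<noteq> 0" and S: "S \<subseteq> carrier_vec n" and xy: "x \<in> carrier_vec n" "y \<in> carrier_vec n"
    and add: "x + y \<in> span S" and diff: "x - y \<in> span S"
  shows "x \<in> span S" "y \<in> span S"
proof -
  have "x = inverse 2 \<cdot>\<^sub>v ((x + y) + (x - y))"
    using xy assms(1) by (intro eq_vecI) (auto simp: field_simps)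
  moreover have "(x + y) + (x - y) \<in> span S"
    using span_add1[OF _ add diff] S by simp
  ultimately show x: "x \<in> span S"
    using smult_in_span[OF S] by metis
  have "y = (x + y) + (- 1) \<cdot>\<^sub>v x"
    using xy by (intro eq_vecI) auto
  moreover have "(x + y) + (- 1) \<cdot>\<^sub>v x \<in> span S"
    using span_add1[OF _ add smult_in_span[OF S x]] S by simp
  ultimately show "y \<in> span S" by metis
qed

lemma unit_vec_in_span_extended_domino_basis:
  assumes mn: "3 \<le> m" "3 \<le> n" and S: "extended_domino_basis m n \<subseteq> carrier_vec (m * n)" and k: "k < m * n"
  shows "unit_vec (m * n) k \<in>
    LinearCombinations.module.span class_ring (module_vec TYPE(complex) (m * n)) (extended_domino_basis m n)"
proof -
  interpret vec_space "TYPE(complex)" "m * n" .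
  let ?S = "extended_domino_basis m n"
  define e f :: "nat \<Rightarrow> complex vec" where "e = unit_vec m" and "f = unit_vec n"
  have dim: "dim_vec (e i) = m" "dim_vec (f i) = n" for i by (auto simp: e_def f_def)
  have carrier: "e i \<otimes>\<^sub>v f j \<in> carrier_vec (m * n)" for i j by (simp add: e_def f_def)
  have domino: "w \<in> span ?S" if "w \<in> domino_states m n" for w
    using that in_own_span[of ?S] S by (auto simp: extended_domino_basis_def)
  note halves = span_add_diff_cancel[OF _ S carrier carrier]
  have "e i \<otimes>\<^sub>v f j \<in> span ?S" if ij: "i < m" "j < n" for i j
  proof (cases "3 \<le> i \<or> 3 \<le> j")
    case True
    then have "e i \<otimes>\<^sub>v f j \<in> ?S"
      using ij unfolding extended_domino_basis_def extension_states_def e_def f_def by blast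
    then show ?thesis using in_own_span[of ?S] S by auto
  next
    case False
    \<comment> \<open>Four dominoes tile the eight outer cells of the 3 by 3 block, each giving a
      sum and a difference of its two cells; the centre cell is a Domino state itself.\<close>
    have "e 0 \<otimes>\<^sub>v f 0 + e 0 \<otimes>\<^sub>v f 1 \<in> span ?S" "e 0 \<otimes>\<^sub>v f 0 - e 0 \<otimes>\<^sub>v f 1 \<in> span ?S"
      "e 0 \<otimes>\<^sub>v f 2 + e 1 \<otimes>\<^sub>v f 2 \<in> span ?S" "e 0 \<otimes>\<^sub>v f 2 - e 1 \<otimes>\<^sub>v f 2 \<in> span ?S"
      "e 2 \<otimes>\<^sub>v f 1 + e 2 \<otimes>\<^sub>v f 2 \<in> span ?S" "e 2 \<otimes>\<^sub>v f 1 - e 2 \<otimes>\<^sub>v f 2 \<in> span ?S"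
      "e 1 \<otimes>\<^sub>v f 0 + e 2 \<otimes>\<^sub>v f 0 \<in> span ?S" "e 1 \<otimes>\<^sub>v f 0 - e 2 \<otimes>\<^sub>v f 0 \<in> span ?S"
      and 11: "e 1 \<otimes>\<^sub>v f 1 \<in> span ?S"
      by (auto intro!: domino simp: domino_states_def Let_def dim e_def[symmetric] f_def[symmetric]
          simp flip: tensor_vec_distribs)
    then have "e 0 \<otimes>\<^sub>v f 0 \<in> span ?S" "e 0 \<otimes>\<^sub>v f 1 \<in> span ?S" "e 0 \<otimes>\<^sub>v f 2 \<in> span ?S"
      "e 1 \<otimes>\<^sub>v f 2 \<in> span ?S" "e 2 \<otimes>\<^sub>v f 1 \<in> span ?S" "e 2 \<otimes>\<^sub>v f 2 \<in> span ?S"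
      "e 1 \<otimes>\<^sub>v f 0 \<in> span ?S" "e 2 \<otimes>\<^sub>v f 0 \<in> span ?S"
      by (auto intro: halves)
    moreover have "i = 0 \<or> i = 1 \<or> i = 2" "j = 0 \<or> j = 1 \<or> j = 2" using False by auto
    ultimately show ?thesis using 11 by auto
  qed
  then show ?thesis
    using tensor_unit_vec[OF tensor_index_bounds[OF k]] tensor_index_bounds[OF k]
    by (metis e_def f_def div_mult_mod_eq)
qed

lemma complete_orthogonal_product_basis_extended_domino:
  assumes mn: "3 \<le> m" "3 \<le> n"
  shows "complete_orthogonal_product_basis m n (extended_domino_basis m n)"
proof -
  let ?S = "extended_domino_basis m n"
  have factors: "\<exists>p \<in> extended_factors m n. w = fst p \<otimes>\<^sub>v snd p" if "w \<in> ?S" for w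
    using that unfolding extended_domino_basis_factors by (auto simp: case_prod_beta)
  have S: "?S \<subseteq> carrier_vec (m * n)"
    using factors extended_factors_carrier by fastforce
  have inner: "(fst p \<otimes>\<^sub>v snd p) \<bullet>c (fst q \<otimes>\<^sub>v snd q) = (fst p \<bullet>c fst q) * (snd p \<bullet>c snd q)"
    if "p \<in> extended_factors m n" "q \<in> extended_factors m n" for p q
    using that[THEN extended_factors_carrier] by (intro cscalar_prod_tensor_vec) (auto dest!: carrier_vecD)
  \<comment> \<open>Different vectors have different factor pairs, so orthogonality can be read off
    the factors.\<close>
  have orth: "u \<bullet>c v = 0" if "u \<in> ?S" "v \<in> ?S" "u \<noteq> v" for u v
    using that factors[of u] factors[of v] inner extended_factors_orthogonal[OF mn] by metis
  have nz: "u \<bullet>c u \<noteq> 0" if "u \<in> ?S" for u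
    using that factors[of u] inner extended_factors_nonzero[OF mn] by metis
  have "product_vector m n w" if "w \<in> ?S" for w
    using factors[OF that] extended_factors_carrier unfolding product_vector_def by blast
  then show ?thesis
    unfolding complete_orthogonal_product_basis_def
    using orthogonal_spanning_imp_basis[OF S orth nz unit_vec_in_span_extended_domino_basis[OF mn S]] orth
    by blast
qed

theorem corollary3:
  fixes m n :: nat
  assumes "3 \<le> m" and "3 \<le> n"
  shows "complete_orthogonal_product_basis m n (extended_domino_basis m n) \<and>
    locc_indistinguishable m n (density ` extended_domino_basis m n)"
  using complete_orthogonal_product_basis_extended_domino[OF assms]
    domino_locc_indistinguishable[OF assms, of "extended_domino_basis m n"]
  by (simp add: extended_domino_basis_def)

end
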